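(* Let $G=\mathbb{Z}^{r_0}\oplus\mathbb{Z}_{q_1}^{r_1}\oplus\cdots\oplus\mathbb{Z}_{q_k}^{r_k}$ be a finitely generated abelian group, where the $q_i$ are powers of (not necessarily distinct) primes, and let $\alpha$ be a positive integer. Let $G'=\mathbb{Z}_\alpha^{r_0}\oplus\mathbb{Z}_{q_1}^{r_1}\oplus\cdots\oplus\mathbb{Z}_{q_k}^{r_k}$, let $n=|G'|$, and let $j$ be the number of elements of $G'$ of order at most $2$. Let $\mathcal S_m$ denote the collection of subsets of $\mathrm{Dih}(G_\alpha)$ of size $m$. If $6\le m\le c_j\sqrt n$, where $c_j=1.3229/\sqrt{111+5j}$, then there are (strictly) more MSTD sets than MDTS sets in $\mathcal S_m$.
   Context: For an abelian group $G$, $\mathrm{Dih}(G)=\mathbb{Z}_2\ltimes G$ is the generalized dihedral group, where the nonidentity element of $\mathbb{Z}_2$ acts on $G$ by inversion; its elements are written $(z,g)$ with $z\in\{0,1\}$, $g\in G$. Elements of $G$ are written as tuples $(g_{0,1},\dots,g_{0,r_0},g_{1,1},\dots,g_{k,r_k})$ with $g_{0,b}\in\mathbb{Z}$ and $g_{a,b}\in\mathbb{Z}_{q_a}$ for $a>0$. $\mathrm{Dih}(G_\alpha)$ is the finite subset $\{(z,(g_{0,1},\dots,g_{0,r_0},\dots,g_{k,r_k}))\in\mathrm{Dih}(G): 0\le g_{0,b}<\alpha \text{ for all } b\}$ of $\mathrm{Dih}(G)$; it has $2n$ elements. For a finite subset $A$ of $\mathrm{Dih}(G)$ (with products taken in $\mathrm{Dih}(G)$),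 $A+A=\{a_1a_2:a_1,a_2\in A\}$ and $A-A=\{a_1a_2^{-1}:a_1,a_2\in A\}$. $A$ is MSTD if $|A+A|>|A-A|$, and MDTS if $|A+A|<|A-A|$. The identity element counts among the elements of order at most $2$. *)

theory Defs
  imports Complex_Main "HOL-Algebra.Algebra" "HOL-Number_Theory.Prime_Powers"
begin

text \<open>
  The semidirect product of \<open>H\<close> acting on \<open>N\<close> via \<open>\<phi>\<close>, with the \<open>H\<close>-component written first:
  \<open>(h, x) (h', x') = (h h', x \<phi>\<^sub>h(x'))\<close>.
\<close>

definition semidirect_product ::
    "('h, 'c) monoid_scheme \<Rightarrow> ('a, 'd) monoid_scheme \<Rightarrow> ('h \<Rightarrow> 'a \<Rightarrow> 'a) \<Rightarrow> ('h \<times> 'a) monoid"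
  where "semidirect_product H N \<phi> =
    \<lparr>carrier = carrier H \<times> carrier N,
     monoid.mult = (\<lambda>(h, x) (h', x'). (h \<otimes>\<^bsub>H\<^esub> h', x \<otimes>\<^bsub>N\<^esub> \<phi> h x')),
     one = (\<one>\<^bsub>H\<^esub>, \<one>\<^bsub>N\<^esub>)\<rparr>"

definition Dih :: "('a, 'c) monoid_scheme \<Rightarrow> (int \<times> 'a) monoid"
  where "Dih G = semidirect_product (integer_mod_group 2) G
           (\<lambda>z g. if z = 0 then g else inv\<^bsub>G\<^esub> g)"

lemma group_Dih:
  assumes "comm_group G"
  shows "group (Dih G)"
proof -
  interpret comm_group G by fact
  have H: "carrier (integer_mod_group 2) = {0, 1}"
    by (auto simp: carrier_integer_mod_group)
  show ?thesis
  proof (rule groupI)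
    fix x assume "x \<in> carrier (Dih G)"
    then obtain z g where x: "x = (z, g)" "z = 0 \<or> z = 1" "g \<in> carrier G"
      by (auto simp: Dih_def semidirect_product_def H)
    let ?y = "(z, if z = 0 then inv\<^bsub>G\<^esub> g else g)"
    have "?y \<in> carrier (Dih G)" "?y \<otimes>\<^bsub>Dih G\<^esub> x = \<one>\<^bsub>Dih G\<^esub>"
      using x by (auto simp: Dih_def semidirect_product_def H)
    then show "\<exists>y\<in>carrier (Dih G). y \<otimes>\<^bsub>Dih G\<^esub> x = \<one>\<^bsub>Dih G\<^esub>" ..
  qed (auto simp: Dih_def semidirect_product_def H m_assoc inv_mult)
qed

text \<open>
  Coordinates are indexed by pairs \<open>(a, b)\<close> with \<open>a \<le> k\<close> and \<open>1 \<le> b \<le> r a\<close>.  The summand at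
  \<open>(0, b)\<close> is \<open>\<int>\<close> for \<open>d = 0\<close> (as \<open>integer_mod_group 0 = integer_group\<close>) and \<open>\<int>\<^sub>d\<close> for \<open>d > 0\<close>;
  the summand at \<open>(a, b)\<close> with \<open>a > 0\<close> is \<open>\<int>\<^bsub>q a\<^esub>\<close>.
\<close>

definition cyclic_sum :: "nat \<Rightarrow> nat \<Rightarrow> (nat \<Rightarrow> nat) \<Rightarrow> (nat \<Rightarrow> nat) \<Rightarrow> (nat \<times> nat \<Rightarrow> int) monoid"
  where "cyclic_sum d k r q =
    product_group (SIGMA a:{..k}. {1..r a})
      (\<lambda>(a, b). integer_mod_group (if a = 0 then d else q a))"

definition fg_abelian :: "nat \<Rightarrow> (nat \<Rightarrow> nat) \<Rightarrow> (nat \<Rightarrow> nat) \<Rightarrow> (nat \<times> nat \<Rightarrow> int) monoid"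
  where "fg_abelian k r q = cyclic_sum 0 k r q"

definition Dih_box ::
    "nat \<Rightarrow> nat \<Rightarrow> (nat \<Rightarrow> nat) \<Rightarrow> (nat \<Rightarrow> nat) \<Rightarrow> (int \<times> (nat \<times> nat \<Rightarrow> int)) set"
  where "Dih_box \<alpha> k r q =
    {(z, g) \<in> carrier (Dih (fg_abelian k r q)).
       \<forall>b \<in> {1..r 0}. 0 \<le> g (0, b) \<and> g (0, b) < int \<alpha>}"

definition num_ord_le_2 :: "('a, 'c) monoid_scheme \<Rightarrow> nat"
  where "num_ord_le_2 G = card {x \<in> carrier G. group.ord G x \<in> {1, 2}}"
  (* group.ord is 0 for elements of infinite order *)

definition MSTD :: "('a, 'c) monoid_scheme \<Rightarrow> 'a set \<Rightarrow> bool"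
  where "MSTD G A \<longleftrightarrow> card (A <#>\<^bsub>G\<^esub> A) > card (A <#>\<^bsub>G\<^esub> (set_inv\<^bsub>G\<^esub> A))"

definition MDTS :: "('a, 'c) monoid_scheme \<Rightarrow> 'a set \<Rightarrow> bool"
  where "MDTS G A \<longleftrightarrow> card (A <#>\<^bsub>G\<^esub> A) < card (A <#>\<^bsub>G\<^esub> (set_inv\<^bsub>G\<^esub> A))"

end

theory Submission
  imports Defs
begin

text \<open>
  Write a subset of the generalized dihedral group of an abelian group (written additively in these
  comments) as a set \<open>R\<close> of \<open>a\<close> rotations together with a set \<open>F\<close> of \<open>b\<close> reflections.  Its sumset
  has the rotations \<open>(R + R) \<union> (F - F)\<close> and the reflections \<open>(F + R) \<union> (F - R)\<close>; its difference
  set has the rotations \<open>(R - R) \<union> (F - F)\<close> and the reflections \<open>F + R\<close>.  If no two of these sums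
  and differences coincide without need, the sumset wins by roughly
  \<open>a b + a (a - 1) / 2 - a (a - 1) = a (2 b + 1 - a) / 2\<close>, because \<open>R - R\<close> is the only place where the
  difference set is larger.  So it wins as soon as \<open>0 < a < 2 b + 1\<close>, which among the sets with
  rotations excludes only those with more than about \<open>2 / 3\<close> rotations.

  Coincidences are rare when \<open>m = a + b\<close> is small compared with \<open>sqrt n\<close>.  With \<open>F\<close> and all
  but one rotation \<open>x\<close> held fixed, every coincidence involving \<open>x\<close> confines it to one position, or to
  \<open>j\<close> positions if the equation contains \<open>2 x\<close> (\<open>sum_overlaps_le\<close>).  Averaging over the deleted
  rotation (\<open>markov_delete_element\<close>) shows that for \<open>1 \<le> a \<le> (4 m + 3) / 7\<close> at most one tenth
  of the sets fail to be MSTD (\<open>few_not_MSTD\<close>).  The cut near \<open>4 / 7\<close> lies between \<open>1 / 2\<close>, so that more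
  than half of all sets are below it, and \<open>2 / 3\<close>, so that the surplus below it is of order \<open>a m\<close>.

  All sets above the cut may be MDTS, but they are outnumbered: there are
  \<open>(n choose a) * (n choose (m - a))\<close> sets with \<open>a\<close> rotations, a number symmetric in \<open>a\<close> and \<open>m - a\<close>
  that increases up to \<open>m / 2\<close> (\<open>split_weights_tail_less\<close>).  Sets without rotations have equal
  sumset and difference set.

  The box of the statement consists of the same tuples as the finite group in which each \<open>\<int>\<close> is
  replaced by \<open>\<int>\<^sub>\<alpha>\<close>, and passing to that group can only increase the number of elements of order at
  most two.
\<close>

section \<open>Averaging over subsets by deleting one element\<close>

text \<open>
  The pair \<open>(R, x)\<close> with \<open>x \<in> R\<close> is the same thing as the pair \<open>(R - {x}, x)\<close>.
  Reading the sum from the second side, everything but \<open>x\<close> is fixed first, so \<open>\<beta>\<close> only has to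
  bound the cost over the choice of one last element.
\<close>

lemma sum_delete_element_le:
  fixes h :: "'a set \<Rightarrow> 'a \<Rightarrow> nat"
  assumes B: "finite B" and a: "0 < a"
    and h: "\<And>R'. R' \<subseteq> B \<Longrightarrow> card R' = a - 1 \<Longrightarrow> (\<Sum>x\<in>B - R'. h R' x) \<le> \<beta>"
  shows "(\<Sum>R | R \<subseteq> B \<and> card R = a. \<Sum>x\<in>R. h (R - {x}) x) \<le> (card B choose (a - 1)) * \<beta>"
proof -
  let ?L = "{R. R \<subseteq> B \<and> card R = a}" and ?K = "{R'. R' \<subseteq> B \<and> card R' = a - 1}"
  have fin: "finite R" if "R \<subseteq> B" for R
    using that B by (rule finite_subset)
  have "(\<Sum>R\<in>?L. \<Sum>x\<in>R. h (R - {x}) x) = (\<Sum>(R, x)\<in>Sigma ?L (\<lambda>R. R). h (R - {x}) x)"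
    using B fin by (intro sum.Sigma) auto
  also have "\<dots> = (\<Sum>(R', x)\<in>Sigma ?K (\<lambda>R'. B - R'). h R' x)"
    by (rule sum.reindex_bij_witness[where j = "\<lambda>(R, x). (R - {x}, x)"
          and i = "\<lambda>(R', x). (insert x R', x)"])
       (use a fin in \<open>auto simp: card_Diff_singleton insert_absorb\<close>)
  also have "\<dots> = (\<Sum>R'\<in>?K. \<Sum>x\<in>B - R'. h R' x)"
    using B by (intro sum.Sigma[symmetric]) auto
  also have "\<dots> \<le> (\<Sum>R'\<in>?K. \<beta>)"
    using h by (intro sum_mono) auto
  also have "\<dots> = (card B choose (a - 1)) * \<beta>"
    using B by (simp add: n_subsets)
  finally show ?thesis .
qed

text \<open>
  A set with property \<open>P\<close> costs at least \<open>a * u\<close>, while the average cost is at most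
  \<open>a * \<beta> / (n - a + 1)\<close> because \<open>(n choose (a - 1)) * (n - a + 1) = a * (n choose a)\<close>.  So the
  sets with property \<open>P\<close> have density at most \<open>\<beta> / (u * (n - a + 1)) \<le> 1 / c\<close>.
\<close>

lemma markov_delete_element:
  fixes h :: "'a set \<Rightarrow> 'a \<Rightarrow> nat"
  assumes B: "finite B" and a: "0 < a" "a \<le> card B"
    and h: "\<And>R'. R' \<subseteq> B \<Longrightarrow> card R' = a - 1 \<Longrightarrow> (\<Sum>x\<in>B - R'. h R' x) \<le> \<beta>"
    and bad: "\<And>R. R \<subseteq> B \<Longrightarrow> card R = a \<Longrightarrow> P R \<Longrightarrow> a * u \<le> (\<Sum>x\<in>R. h (R - {x}) x)"
    and \<beta>: "c * \<beta> \<le> u * (card B - a + 1)" and u: "0 < u"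
  shows "c * card {R. R \<subseteq> B \<and> card R = a \<and> P R} \<le> card B choose a"
proof -
  let ?n = "card B" and ?N = "card {R. R \<subseteq> B \<and> card R = a \<and> P R}"
  have fin: "finite {R. R \<subseteq> B \<and> card R = a}"
    using B by simp
  have "?N * (a * u) = (\<Sum>R | R \<subseteq> B \<and> card R = a \<and> P R. a * u)"
    by simp
  also have "\<dots> \<le> (\<Sum>R | R \<subseteq> B \<and> card R = a \<and> P R. \<Sum>x\<in>R. h (R - {x}) x)"
    using bad by (intro sum_mono) auto
  also have "\<dots> \<le> (\<Sum>R | R \<subseteq> B \<and> card R = a. \<Sum>x\<in>R. h (R - {x}) x)"
    using fin by (intro sum_mono2) auto
  also have "\<dots> \<le> (?n choose (a - 1)) * \<beta>"
    using B a h by (intro sum_delete_element_le) auto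
  finally have 1: "?N * (a * u) \<le> (?n choose (a - 1)) * \<beta>" .
  obtain a' where a': "a = Suc a'"
    using a by (cases a) auto
  have 2: "(?n choose a') * (?n - a') = a * (?n choose a)"
    using binomial_absorption[of a' ?n] binomial_absorb_comp[of ?n a'] by (simp add: a' mult.commute)
  have na: "?n - a + 1 = ?n - a'"
    using a a' by simp
  have "(c * ?N) * (a * u * (?n - a')) \<le> c * ((?n choose a') * \<beta>) * (?n - a')"
    using mult_le_mono1[OF mult_le_mono2[OF 1, of c], of "?n - a'"] by (simp add: a' ac_simps)
  also have "\<dots> = (a * (?n choose a)) * (c * \<beta>)"
    unfolding 2[symmetric] by (simp add: ac_simps)
  also have "\<dots> \<le> (a * (?n choose a)) * (u * (?n - a'))"
    using \<beta> unfolding na by (intro mult_le_mono2)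
  also have "\<dots> = (?n choose a) * (a * u * (?n - a'))"
    by (simp add: ac_simps)
  finally show ?thesis
    using a u a' by simp
qed

section \<open>The weights \<open>(n choose a) * (n choose (m - a))\<close>\<close>

lemma split_weight_step:
  fixes n m a :: nat
  assumes "a < m" "m \<le> n"
  shows "(n choose Suc a) * (n choose (m - Suc a)) * (Suc a * (n - (m - Suc a)))
       = (n choose a) * (n choose (m - a)) * ((n - a) * (m - a))"
proof -
  obtain b where b: "m - a = Suc b" "m - Suc a = b"
    using assms by (metis Suc_diff_Suc)
  have 1: "Suc a * (n choose Suc a) = (n - a) * (n choose a)"
    using binomial_absorption[of a n] binomial_absorb_comp[of n a] by simp
  have 2: "Suc b * (n choose Suc b) = (n - b) * (n choose b)"
    using binomial_absorption[of b n] binomial_absorb_comp[of n b] by simp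
  have "(n choose Suc a) * (n choose b) * (Suc a * (n - b))
      = (Suc a * (n choose Suc a)) * ((n - b) * (n choose b))"
    by (simp only: ac_simps)
  also have "\<dots> = ((n - a) * (n choose a)) * (Suc b * (n choose Suc b))"
    unfolding 1 2 ..
  finally show ?thesis
    unfolding b by (simp only: ac_simps)
qed

lemma split_weight_mono:
  fixes n m a b :: nat
  assumes "a \<le> b" "2 * b \<le> Suc m" "m \<le> n"
  shows "(n choose a) * (n choose (m - a)) \<le> (n choose b) * (n choose (m - b))"
  using assms
proof (induction b rule: dec_induct)
  case (step b)
  have b: "b < m" "Suc b \<le> m - b" "n - (m - Suc b) \<le> n - b"
    using step by auto
  have pos: "0 < Suc b * (n - (m - Suc b))"
    using step by auto
  have "(n choose b) * (n choose (m - b)) * (Suc b * (n - (m - Suc b)))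
      \<le> (n choose b) * (n choose (m - b)) * ((m - b) * (n - b))"
    using b by (intro mult_le_mono2 mult_le_mono)
  also have "\<dots> = (n choose Suc b) * (n choose (m - Suc b)) * (Suc b * (n - (m - Suc b)))"
    unfolding split_weight_step[OF b(1) step.prems(2)] by (simp only: ac_simps)
  finally have "(n choose b) * (n choose (m - b)) \<le> (n choose Suc b) * (n choose (m - Suc b))"
    using pos by (metis mult_le_cancel2)
  then show ?case
    using step by simp
qed simp

text \<open>
  The left-hand side collects the splits with so many rotations that the sumset is not known to win.
  Reflecting \<open>a\<close> to \<open>m - a\<close> turns them into the splits \<open>a < t\<close> with \<open>t\<close> about \<open>3 m / 7\<close>.  The
  splits \<open>1 \<le> a < t\<close> occur on both sides and the middle ones, of which there are at least \<open>t / 4\<close>,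
  are heavier than all of these; that makes up for the loss of the factor \<open>4 / 5\<close>.  The split
  \<open>a = 0\<close>, which has no partner on the right, is lighter than \<open>a = 1\<close> by a factor \<open>m \<ge> 6\<close>.
\<close>

lemma split_weights_tail_less:
  fixes n m A :: nat
  defines "w \<equiv> \<lambda>a. (n choose a) * (n choose (m - a))"
  assumes m: "6 \<le> m" "m \<le> n" and A: "A = (4 * m + 3) div 7"
  shows "10 * (\<Sum>a\<in>{A<..m}. w a) < 8 * (\<Sum>a\<in>{1..A}. w a)"
proof -
  define t where "t = m - A"
  have A7: "7 * A \<le> 4 * m + 3" "4 * m \<le> 7 * A + 3"
    unfolding A by linarith+
  have At: "A + t = m"
    using A7(1) m unfolding t_def by linarith
  have sizes: "2 \<le> t" "2 * t \<le> m" "t \<le> A" "t \<le> 4 * (Suc A - t)" "A < m"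
    using A7 At m by linarith+
  have mono: "w a \<le> w b" if "a \<le> b" "2 * b \<le> Suc m" for a b
    unfolding w_def using that m by (intro split_weight_mono) auto
  have sym: "w (m - a) = w a" if "a \<le> m" for a
    using that by (simp add: w_def)
  have mid: "w t \<le> w a" if "t \<le> a" "a \<le> A" for a
  proof (cases "2 * a \<le> m")
    case True
    then show ?thesis using mono that by simp
  next
    case False
    then have "w t \<le> w (m - a)"
      using that sizes At by (intro mono) auto
    then show ?thesis
      using sym[of a] that sizes by simp
  qed
  have tail: "(\<Sum>a\<in>{A<..m}. w a) = (\<Sum>a\<in>{0..<t}. w a)"
    using sizes At sym
    by (intro sum.reindex_bij_witness[where i = "\<lambda>a. m - a" and j = "\<lambda>a. m - a"]) auto
  also have "\<dots> = w 0 + (\<Sum>a\<in>{1..<t}. w a)"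
    using sizes by (simp add: sum.atLeast_Suc_lessThan)
  finally have tail': "(\<Sum>a\<in>{A<..m}. w a) = w 0 + (\<Sum>a\<in>{1..<t}. w a)" .
  have "{1..A} = {1..<t} \<union> {t..A}"
    using sizes by auto
  then have good: "(\<Sum>a\<in>{1..A}. w a) = (\<Sum>a\<in>{1..<t}. w a) + (\<Sum>a\<in>{t..A}. w a)"
    by (simp only:) (rule sum.union_disjoint, auto)
  have low: "(\<Sum>a\<in>{1..<t}. w a) \<le> (t - 1) * w t"
    using sum_bounded_above[of "{1..<t}" w "w t"] mono sizes by simp
  have high: "(Suc A - t) * w t \<le> (\<Sum>a\<in>{t..A}. w a)"
    using sum_bounded_below[of "{t..A}" "w t" w] mid by simp
  have "6 * w 0 \<le> w t"
  proof -
    have "w 0 * (6 * n) \<le> w 0 * (n * m)"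
      using m by (intro mult_le_mono2) (simp add: mult.commute)
    also have "\<dots> = w 1 * (n - (m - 1))"
      using split_weight_step[of 0 m n] m by (simp add: w_def)
    also have "\<dots> \<le> w 1 * n"
      by simp
    finally have "6 * w 0 \<le> w 1"
      using m by (simp add: mult.assoc[symmetric] mult.commute)
    also have "\<dots> \<le> w t"
      using sizes by (intro mono) auto
    finally show ?thesis .
  qed
  moreover have "0 < w t"
    using m sizes by (simp add: w_def zero_less_binomial)
  moreover have "(\<Sum>a\<in>{1..<t}. w a) + w t \<le> t * w t"
    using low sizes by (cases t) auto
  moreover have "t * w t \<le> 4 * (\<Sum>a\<in>{t..A}. w a)"
  proof -
    have "t * w t \<le> 4 * ((Suc A - t) * w t)"
      using mult_le_mono1[OF sizes(4), of "w t"] by (simp only: mult.assoc)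
    then show ?thesis
      using high by linarith
  qed
  moreover have "5 * w 0 < w t"
    using calculation(1,2) by (cases "w 0 = 0") auto
  ultimately have "10 * w 0 + 10 * (\<Sum>a\<in>{1..<t}. w a)
      < 8 * (\<Sum>a\<in>{1..<t}. w a) + 8 * (\<Sum>a\<in>{t..A}. w a)"
    by linarith
  then show ?thesis
    unfolding tail' good by (simp only: distrib_left)
qed

section \<open>Numerical estimates\<close>

text \<open>
  This is the condition of \<open>markov_delete_element\<close> with \<open>c = 10\<close> for the bound on the cost given by
  \<open>sum_overlaps_le\<close>.  The restriction on \<open>a\<close> makes \<open>u \<ge> 2 * (m - 1) / 7\<close>, so that the right-hand
  side is of order \<open>m\<^sup>3 * (60 + 2 * j)\<close>.  The left-hand side is at most \<open>25 / 2 * m\<^sup>3 + 20 * b\<^sup>2 * j\<close>,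
  and the parts with and without \<open>j\<close> are compared separately.
\<close>

lemma expected_overlaps_small:
  fixes a b m n j u :: nat
  assumes m: "6 \<le> m" and ab: "a + b = m" and a: "7 * a \<le> 4 * m + 3"
    and u: "u + a = 2 * b + 1" and n: "m + m\<^sup>2 * (60 + 2 * j) \<le> n"
  shows "10 * (a * (5 * b\<^sup>2 + a\<^sup>2) + 2 * b\<^sup>2 * j) \<le> u * (n - a + 1)"
proof -
  define x y M v :: real where "x = a" and "y = b" and "M = m" and "v = u"
  have M: "M \<ge> 6" "M = x + y" and xy: "x \<ge> 0" "y \<ge> 0"
    and v: "v = 2 * y + 1 - x" "7 * v \<ge> 2 * (M - 1)"
    using m ab a u by (auto simp: x_def y_def M_def v_def)
  have "10 * (x * (5 * y\<^sup>2 + x\<^sup>2)) \<le> 25/2 * M^3"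
  proof -
    have "4 * (x * y) \<le> M\<^sup>2"
      using M zero_le_power2[of "x - y"] by (simp add: power2_eq_square algebra_simps)
    then have "25/2 * y * (4 * (x * y)) \<le> 25/2 * y * M\<^sup>2"
      using xy by (intro mult_left_mono) auto
    moreover have "10 * x * x\<^sup>2 \<le> 10 * x * M\<^sup>2"
      using M xy by (intro mult_left_mono power_mono) auto
    moreover have "10 * x * M\<^sup>2 \<le> 25/2 * x * M\<^sup>2"
      using xy by (intro mult_right_mono) auto
    ultimately have "10 * (x * (5 * y\<^sup>2 + x\<^sup>2)) \<le> 25/2 * y * M\<^sup>2 + 25/2 * x * M\<^sup>2"
      by (simp add: power2_eq_square algebra_simps)
    also have "\<dots> = 25/2 * M * M\<^sup>2"
      unfolding M(2) by (simp only: distrib_left distrib_right add.commute)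
    also have "\<dots> = 25/2 * M^3"
      by (simp add: power2_eq_square power3_eq_cube)
    finally show ?thesis .
  qed
  \<comment> \<open>Since \<open>M \<ge> 6\<close>, the lower bound for \<open>v\<close> is at least \<open>5 / 21 * M\<close>, and \<open>60 * 5 / 21 > 25 / 2\<close>.\<close>
  also have "\<dots> \<le> v * (60 * M\<^sup>2)"
  proof -
    have "25/2 * M \<le> 60 * v"
      using M(1) v(2) by (simp add: field_simps)
    then have "25/2 * M * M\<^sup>2 \<le> 60 * v * M\<^sup>2"
      by (intro mult_right_mono) auto
    then show ?thesis
      by (simp add: power2_eq_square power3_eq_cube algebra_simps)
  qed
  finally have main: "10 * (x * (5 * y\<^sup>2 + x\<^sup>2)) \<le> v * (60 * M\<^sup>2)" .
  have tors: "20 * y\<^sup>2 \<le> v * (2 * M\<^sup>2)"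
  proof (cases "a = 0")
    case True
    then have "x = 0" by (simp add: x_def)
    then have "y = M" "v \<ge> 10" using M v by auto
    then show ?thesis using mult_right_mono[of 10 v "2 * M\<^sup>2"] by simp
  next
    case False
    then have "x \<ge> 1" by (simp add: x_def)
    have e: "3 * y = (M - 1) + v" "v \<le> 2 * (M - 1)"
      using M v \<open>x \<ge> 1\<close> by auto
    \<comment> \<open>\<open>(3 y)\<^sup>2\<close> is convex in \<open>v\<close>, so on \<open>2 (M - 1) / 7 \<le> v \<le> 2 (M - 1)\<close> it lies below its chord.\<close>
    have "0 \<le> (7 * v - 2 * (M - 1)) * (2 * (M - 1) - v)"
      using e v by (intro mult_nonneg_nonneg) auto
    then have "(3 * y)\<^sup>2 \<le> (3 * (M - 1) + 30 * v) * (M - 1) / 7"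
      unfolding e by (simp add: power2_eq_square algebra_simps)
    also have "\<dots> \<le> (81/2 * v) * (M - 1) / 7"
      using M v by (intro divide_right_mono mult_right_mono) auto
    finally have "20 * y\<^sup>2 \<le> (90/7) * (v * (M - 1))"
      by (simp add: power2_eq_square algebra_simps)
    also have "\<dots> \<le> v * (2 * M\<^sup>2)"
    proof -
      have "90/7 * (M - 1) \<le> 2 * M\<^sup>2"
        using M mult_right_mono[of 6 M M] zero_le_power2[of "M - 6"]
        by (simp add: power2_eq_square algebra_simps)
      then have "v * (90/7 * (M - 1)) \<le> v * (2 * M\<^sup>2)"
        using v M by (intro mult_left_mono) auto
      then show ?thesis by (simp add: algebra_simps)
    qed
    finally show ?thesis .
  qed
  have "10 * (x * (5 * y\<^sup>2 + x\<^sup>2) + 2 * y\<^sup>2 * j)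
      = 10 * (x * (5 * y\<^sup>2 + x\<^sup>2)) + 20 * y\<^sup>2 * j"
    by (simp add: algebra_simps)
  also have "\<dots> \<le> v * (60 * M\<^sup>2) + v * (2 * M\<^sup>2) * j"
    using main tors by (intro add_mono mult_right_mono) auto
  also have "\<dots> = v * (M\<^sup>2 * (60 + 2 * j))"
    by (simp add: algebra_simps)
  finally have "real (10 * (a * (5 * b\<^sup>2 + a\<^sup>2) + 2 * b\<^sup>2 * j)) \<le> real (u * (m\<^sup>2 * (60 + 2 * j)))"
    by (simp add: x_def y_def M_def v_def)
  then have "10 * (a * (5 * b\<^sup>2 + a\<^sup>2) + 2 * b\<^sup>2 * j) \<le> u * (m\<^sup>2 * (60 + 2 * j))"
    by (rule of_nat_le_iff[THEN iffD1])
  also have "\<dots> \<le> u * (n - a + 1)"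
    using n ab by (intro mult_le_mono2) simp
  finally show ?thesis .
qed

text \<open>
  Squaring gives \<open>m\<^sup>2 * (111 + 5 * j) \<le> 9 / 5 * n\<close>, and \<open>5 / 9 * 111\<close> exceeds \<open>60\<close> by more than
  \<open>1\<close>, which leaves room for the summand \<open>m\<close>.
\<close>

lemma size_bound_imp_quadratic:
  fixes m n j :: nat
  assumes m: "6 \<le> m" and mn: "real m \<le> 1.3229 / sqrt (111 + 5 * real j) * sqrt (real n)"
  shows "m + m\<^sup>2 * (60 + 2 * j) \<le> n"
proof -
  have "(real m)\<^sup>2 \<le> (1.3229 / sqrt (111 + 5 * real j) * sqrt (real n))\<^sup>2"
    using mn by (intro power_mono) auto
  also have "\<dots> = 1.3229\<^sup>2 * n / (111 + 5 * real j)"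
    by (simp add: power_divide power_mult_distrib)
  finally have 1: "(real m)\<^sup>2 * (111 + 5 * real j) \<le> 1.3229\<^sup>2 * n"
    by (simp add: field_simps add_pos_nonneg)
  define p q :: real where "p = (real m)\<^sup>2" and "q = (real m)\<^sup>2 * j"
  have "111 * p + 5 * q \<le> 9/5 * n"
    using 1 by (simp add: p_def q_def distrib_left power_divide mult_ac)
  moreover have "real m \<le> p" "0 \<le> q"
    using m by (simp_all add: p_def q_def power2_eq_square)
  ultimately have "m + (60 * p + 2 * q) \<le> n"
    by linarith
  then have "real (m + m\<^sup>2 * (60 + 2 * j)) \<le> real n"
    by (simp add: p_def q_def algebra_simps)
  then show ?thesis
    by (rule of_nat_le_iff[THEN iffD1])
qed

section \<open>Sums and differences in a generalized dihedral group\<close>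

definition dih_set :: "'a set \<Rightarrow> 'a set \<Rightarrow> (int \<times> 'a) set"
  where "dih_set R F = {0} \<times> R \<union> {1} \<times> F"

lemma dih_set_simps [simp]:
  "(0, x) \<in> dih_set R F \<longleftrightarrow> x \<in> R" "(1, x) \<in> dih_set R F \<longleftrightarrow> x \<in> F"
  by (auto simp: dih_set_def)

lemma card_dih_set:
  assumes "finite R" "finite F"
  shows "card (dih_set R F) = card R + card F"
proof -
  have "finite ({0 :: int} \<times> R)" "finite ({1 :: int} \<times> F)"
    using assms by simp_all
  moreover have "({0 :: int} \<times> R) \<inter> ({1} \<times> F) = {}"
    by (rule equals0I) force
  ultimately have "card (dih_set R F) = card ({0 :: int} \<times> R) + card ({1 :: int} \<times> F)"
    unfolding dih_set_def by (rule card_Un_disjoint)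
  then show ?thesis
    by (simp only: card_cartesian_product) simp
qed

lemma carrier_Dih: "carrier (Dih G) = {0, 1} \<times> carrier G"
  by (auto simp: Dih_def semidirect_product_def carrier_integer_mod_group)

lemma mult_Dih:
  "(z, x) \<otimes>\<^bsub>Dih G\<^esub> (w, y) = ((z + w) mod 2, x \<otimes>\<^bsub>G\<^esub> (if z = 0 then y else inv\<^bsub>G\<^esub> y))"
  by (simp add: Dih_def semidirect_product_def)

lemma one_Dih: "\<one>\<^bsub>Dih G\<^esub> = (0, \<one>\<^bsub>G\<^esub>)"
  by (simp add: Dih_def semidirect_product_def)

lemma set_mult_image: "H <#>\<^bsub>G\<^esub> K = (\<lambda>(h, k). h \<otimes>\<^bsub>G\<^esub> k) ` (H \<times> K)"
  by (auto simp: set_mult_def)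

lemma set_inv_image: "set_inv\<^bsub>G\<^esub> H = (\<lambda>h. inv\<^bsub>G\<^esub> h) ` H"
  by (auto simp: SET_INV_def)

lemma card_set_mult_le:
  assumes "finite H" "finite K"
  shows "card (H <#>\<^bsub>G\<^esub> K) \<le> card H * card K"
  unfolding set_mult_image using assms
  by (metis card_image_le card_cartesian_product finite_cartesian_product)

lemma finite_set_mult: "finite H \<Longrightarrow> finite K \<Longrightarrow> finite (H <#>\<^bsub>G\<^esub> K)"
  by (simp add: set_mult_image)

lemma card_set_inv_le: "finite H \<Longrightarrow> card (set_inv\<^bsub>G\<^esub> H) \<le> card H"
  by (simp add: set_inv_image card_image_le)

lemma finite_set_inv: "finite H \<Longrightarrow> finite (set_inv\<^bsub>G\<^esub> H)"
  by (simp add: set_inv_image)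

lemma sum_card_Collect_swap:
  assumes "finite A" "finite Y"
  shows "sum (\<lambda>x. card {y \<in> Y. P x y}) A = sum (\<lambda>y. card {x \<in> A. P x y}) Y"
proof -
  have "sum (\<lambda>x. card {y \<in> Y. P x y}) A = (\<Sum>x\<in>A. \<Sum>y\<in>Y. if P x y then 1 else 0)"
    using assms by (intro sum.cong refl) (simp add: sum.inter_filter[symmetric])
  also have "\<dots> = (\<Sum>y\<in>Y. \<Sum>x\<in>A. if P x y then 1 else 0)"
    by (rule sum.swap)
  also have "\<dots> = sum (\<lambda>y. card {x \<in> A. P x y}) Y"
    using assms by (intro sum.cong refl) (simp add: sum.inter_filter[symmetric])
  finally show ?thesis .
qed

lemma card_le_two_times_card_image:
  assumes S: "finite S" and fib: "\<And>p q. p \<in> S \<Longrightarrow> q \<in> S \<Longrightarrow> f p = f q \<Longrightarrow> q = p \<or> q = g p"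
  shows "card S \<le> 2 * card (f ` S)"
proof -
  have "card {q \<in> S. f q = v} \<le> 2" if v: "v \<in> f ` S" for v
  proof -
    obtain p where p: "p \<in> S" "v = f p"
      using v by blast
    then have "{q \<in> S. f q = v} \<subseteq> {p, g p}"
      using fib[OF p(1)] p(2) by fastforce
    then have "card {q \<in> S. f q = v} \<le> card {p, g p}"
      by (intro card_mono) auto
    also have "\<dots> \<le> 2"
      by (simp add: card_insert_if)
    finally show ?thesis .
  qed
  moreover have "card S = (\<Sum>v\<in>f ` S. card {q \<in> S. f q = v})"
    using S sum.image_gen[of S "\<lambda>_. 1 :: nat" f] by simp
  ultimately show ?thesis
    using sum_bounded_above[of "f ` S" "\<lambda>v. card {q \<in> S. f q = v}" 2] by simp
qed

context comm_group
begin

lemma inv_Dih: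
  assumes "x \<in> carrier G"
  shows "inv\<^bsub>Dih G\<^esub> (0, x) = (0, inv x)" "inv\<^bsub>Dih G\<^esub> (1, x) = (1, x)"
proof -
  interpret D: group "Dih G"
    by (rule group_Dih) (rule comm_group_axioms)
  show "inv\<^bsub>Dih G\<^esub> (0, x) = (0, inv x)" "inv\<^bsub>Dih G\<^esub> (1, x) = (1, x)"
    using assms by (auto intro!: D.inv_equality simp: mult_Dih one_Dih carrier_Dih)
qed

lemma set_mult_commute:
  assumes "H \<subseteq> carrier G" "K \<subseteq> carrier G"
  shows "H <#> K = K <#> H"
proof -
  have "A <#> B \<subseteq> B <#> A" if sub: "A \<subseteq> carrier G" "B \<subseteq> carrier G" for A B
  proof
    fix v assume "v \<in> A <#> B"
    then obtain x y where v: "v = x \<otimes> y" "x \<in> A" "y \<in> B"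
      by (auto simp: set_mult_def)
    then have "v = y \<otimes> x"
      using sub m_comm by auto
    then show "v \<in> B <#> A"
      using v by (auto simp: set_mult_def)
  qed
  then show ?thesis
    using assms by (intro equalityI)
qed

lemma set_mult_dih_set:
  "dih_set R F <#>\<^bsub>Dih G\<^esub> dih_set R' F' =
    dih_set ((R <#> R') \<union> (F <#> set_inv F')) ((R <#> F') \<union> (F <#> set_inv R'))"
proof -
  have rot: "({0} \<times> A) <#>\<^bsub>Dih G\<^esub> ({w} \<times> B) = {w mod 2} \<times> (A <#> B)"
    for A B :: "'a set" and w
    by (auto simp: set_mult_def mult_Dih) blast+
  have ref: "({1} \<times> A) <#>\<^bsub>Dih G\<^esub> ({w} \<times> B) = {(1 + w) mod 2} \<times> (A <#> set_inv B)"
    for A B :: "'a set" and w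
    by (auto simp: set_mult_def SET_INV_def mult_Dih) blast+
  have Un: "(A \<union> B) <#>\<^bsub>Dih G\<^esub> (C \<union> D) =
      (A <#>\<^bsub>Dih G\<^esub> C) \<union> (A <#>\<^bsub>Dih G\<^esub> D) \<union> (B <#>\<^bsub>Dih G\<^esub> C) \<union> (B <#>\<^bsub>Dih G\<^esub> D)"
    for A B C D
    by (auto simp: set_mult_def)
  show ?thesis
    unfolding dih_set_def Un rot ref by auto
qed

lemma set_inv_dih_set:
  assumes "R \<subseteq> carrier G" "F \<subseteq> carrier G"
  shows "set_inv\<^bsub>Dih G\<^esub> (dih_set R F) = dih_set (set_inv R) F"
proof -
  have "set_inv\<^bsub>Dih G\<^esub> (dih_set R F)
      = (\<lambda>x. inv\<^bsub>Dih G\<^esub> x) ` ({0} \<times> R) \<union> (\<lambda>x. inv\<^bsub>Dih G\<^esub> x) ` ({1} \<times> F)"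
    by (simp add: set_inv_image dih_set_def image_Un)
  also have "(\<lambda>x. inv\<^bsub>Dih G\<^esub> x) ` ({0} \<times> R) = {0} \<times> set_inv R"
    using assms by (force simp: set_inv_image inv_Dih)
  also have "(\<lambda>x. inv\<^bsub>Dih G\<^esub> x) ` ({1} \<times> F) = {1} \<times> F"
    using assms by (force simp: inv_Dih)
  finally show ?thesis
    by (simp add: dih_set_def)
qed

lemma difference_dih_set:
  assumes R: "R \<subseteq> carrier G" and F: "F \<subseteq> carrier G"
  shows "dih_set R F <#>\<^bsub>Dih G\<^esub> set_inv\<^bsub>Dih G\<^esub> (dih_set R F) =
    dih_set ((R <#> set_inv R) \<union> (F <#> set_inv F)) (R <#> F)"
proof -
  have "set_inv (set_inv R) = R"
    using R by (force simp: set_inv_image)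
  moreover have "F <#> R = R <#> F"
    using R F by (intro set_mult_commute)
  ultimately show ?thesis
    using assms by (simp add: set_inv_dih_set set_mult_dih_set)
qed

text \<open>
  The damage done by adding the rotation \<open>x\<close> to the rotations \<open>R'\<close>, measured in halves of an element of
  the sumset.  A rotation \<open>x + y\<close> is counted as lost if it is also a difference of reflections or a
  sum of rotations other than \<open>x\<close>; the pair \<open>{x, y}\<close> is met from \<open>x\<close> and from \<open>y\<close>, so each time it
  has weight one.  A reflection \<open>f - x\<close> is counted as lost if it arises from another rotation or lies
  in \<open>F + R\<close>; it is met only from \<open>x\<close> and has weight two.
\<close>

definition overlaps :: "'a set \<Rightarrow> 'a set \<Rightarrow> 'a \<Rightarrow> nat"
  where "overlaps F R' x =
    card {y \<in> R'. x \<otimes> y \<in> (F <#> set_inv F) \<union> (R' <#> R')} +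
    2 * card {f \<in> F. f \<otimes> inv x \<in> (F <#> set_inv R') \<union> (F <#> insert x R')}"

text \<open>
  The sums \<open>x + x\<close> are given up.  If the pair \<open>(x, y)\<close> is not lost, then \<open>x\<close> occurs in every other
  pair with the same sum, so by cancellation that pair is \<open>(y, x)\<close>.
\<close>

lemma card_rotation_sums_ge:
  assumes R: "finite R" "R \<subseteq> carrier G"
  shows "card R * (card R - 1) \<le> 2 * card ((R <#> R) - V)
    + (\<Sum>x\<in>R. card {y \<in> R - {x}. x \<otimes> y \<in> V \<union> ((R - {x}) <#> (R - {x}))})"
proof -
  define N where "N = (\<lambda>x. {y \<in> R - {x}. x \<otimes> y \<in> V \<union> ((R - {x}) <#> (R - {x}))})"
  define S where "S = (SIGMA x:R. R - {x} - N x)"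
  have "card S \<le> 2 * card ((\<lambda>(x, y). x \<otimes> y) ` S)"
  proof (rule card_le_two_times_card_image[where g = prod.swap])
    fix p q
    assume "p \<in> S" "q \<in> S"
      and eq: "(case p of (x, y) \<Rightarrow> x \<otimes> y) = (case q of (x, y) \<Rightarrow> x \<otimes> y)"
    then obtain x y z w where p: "p = (x, y)" "x \<in> R" "y \<in> R" "x \<noteq> y" "y \<notin> N x"
      and q: "q = (z, w)" "z \<in> R" "w \<in> R" "z \<noteq> w"
      by (auto simp: S_def)
    have e: "x \<otimes> y = z \<otimes> w"
      using eq by (simp add: p q)
    have c: "x \<in> carrier G" "y \<in> carrier G" "z \<in> carrier G" "w \<in> carrier G"
      using p q R by auto
    have "z = x \<or> w = x"
    proof (rule ccontr)
      assume "\<not> (z = x \<or> w = x)"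
      then have "x \<otimes> y \<in> (R - {x}) <#> (R - {x})"
        unfolding e using q by (auto simp: set_mult_def)
      then show False
        using p by (auto simp: N_def)
    qed
    then show "q = p \<or> q = prod.swap p"
      using e c m_comm[of x y] m_comm[of z w] by (auto simp: p q)
  qed (use R in \<open>auto simp: S_def\<close>)
  also have "\<dots> \<le> 2 * card ((R <#> R) - V)"
    using R by (intro mult_le_mono2 card_mono finite_Diff finite_set_mult)
      (auto simp: S_def N_def set_mult_def)
  finally have 1: "card S \<le> 2 * card ((R <#> R) - V)" .
  have "card S + (\<Sum>x\<in>R. card (N x)) = (\<Sum>x\<in>R. card (R - {x} - N x) + card (N x))"
    using R by (simp add: S_def sum.distrib)
  also have "\<dots> = (\<Sum>x\<in>R. card R - 1)"
  proof (intro sum.cong refl)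
    fix x assume "x \<in> R"
    have "N x \<subseteq> R - {x}"
      by (auto simp: N_def)
    then have "card (R - {x} - N x) + card (N x) = card (R - {x})"
      using R by (metis card_Diff_subset card_mono finite_Diff finite_subset le_add_diff_inverse2)
    then show "card (R - {x} - N x) + card (N x) = card R - 1"
      using \<open>x \<in> R\<close> R by simp
  qed
  finally show ?thesis
    using 1 R unfolding N_def by simp
qed

lemma card_reflection_sums_ge:
  assumes R: "finite R" "R \<subseteq> carrier G" and F: "finite F" "F \<subseteq> carrier G"
  shows "card R * card F \<le> card ((F <#> set_inv R) - (F <#> R))
    + (\<Sum>x\<in>R. card {f \<in> F. f \<otimes> inv x \<in> (F <#> set_inv (R - {x})) \<union> (F <#> R)})"
proof -
  define N where "N = (\<lambda>x. {f \<in> F. f \<otimes> inv x \<in> (F <#> set_inv (R - {x})) \<union> (F <#> R)})"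
  define S where "S = (SIGMA x:R. F - N x)"
  have "inj_on (\<lambda>(x, f). f \<otimes> inv x) S"
  proof (rule inj_onI)
    fix p q
    assume "p \<in> S" "q \<in> S"
      and eq: "(case p of (x, f) \<Rightarrow> f \<otimes> inv x) = (case q of (x, f) \<Rightarrow> f \<otimes> inv x)"
    then obtain x f x' f' where p: "p = (x, f)" "x \<in> R" "f \<in> F" "f \<notin> N x"
      and q: "q = (x', f')" "x' \<in> R" "f' \<in> F"
      by (auto simp: S_def)
    have e: "f \<otimes> inv x = f' \<otimes> inv x'"
      using eq by (simp add: p q)
    have c: "x \<in> carrier G" "f \<in> carrier G" "x' \<in> carrier G" "f' \<in> carrier G"
      using p q R F by auto
    have "x' = x"
    proof (rule ccontr)
      assume "x' \<noteq> x"
      then have "f \<otimes> inv x \<in> F <#> set_inv (R - {x})"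
        unfolding e using q by (auto simp: set_mult_def SET_INV_def)
      then show False
        using p by (auto simp: N_def)
    qed
    then show "p = q"
      using e c by (auto simp: p q)
  qed
  then have "card S = card ((\<lambda>(x, f). f \<otimes> inv x) ` S)"
    by (simp add: card_image)
  also have "\<dots> \<le> card ((F <#> set_inv R) - (F <#> R))"
    using R F by (intro card_mono finite_Diff finite_set_mult finite_set_inv)
      (auto simp: S_def N_def set_mult_def SET_INV_def)
  finally have 1: "card S \<le> card ((F <#> set_inv R) - (F <#> R))" .
  have "card S + (\<Sum>x\<in>R. card (N x)) = (\<Sum>x\<in>R. card (F - N x) + card (N x))"
    using R F by (simp add: S_def sum.distrib)
  also have "\<dots> = (\<Sum>x\<in>R. card F)"
  proof (intro sum.cong refl)
    fix x assume "x \<in> R"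
    have "N x \<subseteq> F"
      by (auto simp: N_def)
    then show "card (F - N x) + card (N x) = card F"
      using F by (metis card_Diff_subset card_mono finite_subset le_add_diff_inverse2)
  qed
  finally show ?thesis
    using 1 unfolding N_def by simp
qed

lemma card_rotation_differences_le:
  assumes R: "finite R" "R \<subseteq> carrier G" and V: "\<one> \<in> V"
  shows "card ((R <#> set_inv R) - V) \<le> card R * (card R - 1)"
proof -
  have "(R <#> set_inv R) - V \<subseteq> (\<lambda>(x, y). x \<otimes> inv y) ` (SIGMA x:R. R - {x})"
  proof
    fix v assume "v \<in> (R <#> set_inv R) - V"
    then obtain x y where v: "v = x \<otimes> inv y" "x \<in> R" "y \<in> R" "v \<notin> V"
      by (auto simp: set_mult_def SET_INV_def)
    have "x \<noteq> y"
      using v V R by (metis r_inv subsetD)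
    then show "v \<in> (\<lambda>(x, y). x \<otimes> inv y) ` (SIGMA x:R. R - {x})"
      using v by force
  qed
  then have "card ((R <#> set_inv R) - V) \<le> card ((\<lambda>(x, y). x \<otimes> inv y) ` (SIGMA x:R. R - {x}))"
    using R by (intro card_mono) auto
  also have "\<dots> \<le> card (SIGMA x:R. R - {x})"
    using R by (intro card_image_le) auto
  also have "\<dots> = card R * (card R - 1)"
    using R by simp
  finally show ?thesis .
qed

text \<open>
  With \<open>a\<close> rotations and \<open>b\<close> reflections, the sumset contains the reflections \<open>f - x\<close> on top of
  the reflections \<open>f + x\<close> common to both sets, a gain of \<open>a * b\<close>.  Among the rotations it has about
  \<open>a * (a - 1) / 2\<close> sums of distinct elements against at most \<open>a * (a - 1)\<close> nonzero differences.
  Half of \<open>a * u = 2 * a * b + a * (a - 1) - 2 * a * (a - 1)\<close> is therefore the surplus of the sumset,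
  which only overlaps can destroy.
\<close>

lemma surplus_le_overlaps:
  assumes R: "finite R" "R \<subseteq> carrier G" and F: "finite F" "F \<subseteq> carrier G" "F \<noteq> {}"
    and u: "u + card R = 2 * card F + 1"
    and not: "\<not> MSTD (Dih G) (dih_set R F)"
  shows "card R * u \<le> (\<Sum>x\<in>R. overlaps F (R - {x}) x)"
proof -
  define V where "V = F <#> set_inv F"
  have comm: "R <#> F = F <#> R"
    using R F by (intro set_mult_commute)
  have "\<one> \<in> V"
  proof -
    obtain f where f: "f \<in> F"
      using F by auto
    then have "f \<otimes> inv f \<in> V"
      unfolding V_def set_mult_def SET_INV_def by blast
    then show ?thesis
      using f F by auto
  qed
  have U: "card (A \<union> B) = card (A - B) + card B" if "finite A" "finite B" for A B :: "'a set"
    using that card_Un_disjoint[of "A - B" B] by (simp add: Diff_disjoint Int_commute)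
  have fin: "finite V" "finite (R <#> R)" "finite (R <#> set_inv R)" "finite (F <#> R)"
      "finite (F <#> set_inv R)"
    using R F by (simp_all add: V_def finite_set_mult finite_set_inv)
  have sum: "card (dih_set R F <#>\<^bsub>Dih G\<^esub> dih_set R F)
      = card ((R <#> R) \<union> V) + card ((F <#> R) \<union> (F <#> set_inv R))"
    unfolding set_mult_dih_set V_def[symmetric] comm using fin by (intro card_dih_set) auto
  have diff: "card (dih_set R F <#>\<^bsub>Dih G\<^esub> set_inv\<^bsub>Dih G\<^esub> (dih_set R F))
      = card ((R <#> set_inv R) \<union> V) + card (F <#> R)"
    unfolding difference_dih_set[OF R(2) F(2)] V_def[symmetric] comm using fin
    by (intro card_dih_set) auto
  have "card ((R <#> R) \<union> V) + card ((F <#> set_inv R) \<union> (F <#> R))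
      \<le> card ((R <#> set_inv R) \<union> V) + card (F <#> R)"
    using not unfolding MSTD_def sum diff by (simp add: Un_commute)
  then have 1: "card ((R <#> R) - V) + card ((F <#> set_inv R) - (F <#> R))
      \<le> card ((R <#> set_inv R) - V)"
    using fin by (simp add: U)
  note 2 = card_rotation_differences_le[OF R \<open>\<one> \<in> V\<close>]
  define P where "P = (\<Sum>x\<in>R. card {y \<in> R - {x}. x \<otimes> y \<in> V \<union> ((R - {x}) <#> (R - {x}))})"
  define Q where "Q = (\<Sum>x\<in>R. card {f \<in> F. f \<otimes> inv x \<in> (F <#> set_inv (R - {x})) \<union> (F <#> R)})"
  have 3: "card R * (card R - 1) \<le> 2 * card ((R <#> R) - V) + P"
    unfolding P_def by (rule card_rotation_sums_ge[OF R])
  have 4: "card R * card F \<le> card ((F <#> set_inv R) - (F <#> R)) + Q"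
    unfolding Q_def by (rule card_reflection_sums_ge[OF R F(1,2)])
  have PQ: "(\<Sum>x\<in>R. overlaps F (R - {x}) x) = P + 2 * Q"
    by (simp add: overlaps_def P_def Q_def V_def sum.distrib sum_distrib_left insert_absorb)
  have "2 * (card R * card F) \<le> card R * (card R - 1) + (P + 2 * Q)"
    using 1 2 3 4 by linarith
  moreover have "card R * u + card R * (card R - 1) = 2 * (card R * card F)"
  proof (cases "card R")
    case (Suc r)
    then have "u + r = 2 * card F"
      using u by simp
    then have "card R * (u + r) = card R * (2 * card F)"
      by simp
    then show ?thesis
      using Suc by (simp add: distrib_left)
  qed simp
  ultimately show ?thesis
    unfolding PQ by linarith
qed

lemma not_MDTS_reflections:
  assumes F: "F \<subseteq> carrier G"
  shows "\<not> MDTS (Dih G) (dih_set {} F)"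
proof -
  have "{} <#> K = {}" "K <#> {} = {}" "set_inv {} = {}" for K
    by (simp_all add: set_mult_def SET_INV_def)
  then show ?thesis
    using F unfolding MDTS_def by (simp add: difference_dih_set set_mult_dih_set)
qed

section \<open>Overlaps are rare\<close>

text \<open>Two square roots of \<open>c\<close> differ by a square root of \<open>\<one>\<close>.\<close>

lemma card_square_roots_le:
  assumes T: "finite {x \<in> carrier G. x \<otimes> x = \<one>}" and B: "B \<subseteq> carrier G"
  shows "card {x \<in> B. x \<otimes> x = c} \<le> card {x \<in> carrier G. x \<otimes> x = \<one>}"
proof (cases "{x \<in> B. x \<otimes> x = c} = {}")
  case False
  then obtain y where y: "y \<in> carrier G" "y \<otimes> y = c"
    using B by auto
  show ?thesis
  proof (rule card_inj_on_le[OF _ _ T])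
    show "inj_on (\<lambda>x. x \<otimes> inv y) {x \<in> B. x \<otimes> x = c}"
      using B y by (intro inj_on_subset[OF inj_on_multc]) auto
    show "(\<lambda>x. x \<otimes> inv y) ` {x \<in> B. x \<otimes> x = c} \<subseteq> {x \<in> carrier G. x \<otimes> x = \<one>}"
    proof safe
      fix x assume x: "x \<in> B" "c = x \<otimes> x"
      then have "x \<in> carrier G" using B by auto
      then have "x \<otimes> inv y \<otimes> (x \<otimes> inv y) = (x \<otimes> x) \<otimes> inv (y \<otimes> y)"
        using y(1) by (simp add: inv_mult m_ac)
      also have "\<dots> = \<one>"
        using x y \<open>x \<in> carrier G\<close> by simp
      finally show "x \<otimes> inv y \<otimes> (x \<otimes> inv y) = \<one>" .
    qed (use B y in auto)
  qed
qed (simp only: card.empty le0)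

lemma card_mult_in_le:
  assumes "B \<subseteq> carrier G" "y \<in> carrier G" "finite V"
  shows "card {x \<in> B. x \<otimes> y \<in> V} \<le> card V"
  using assms by (intro card_inj_on_le[of "\<lambda>x. x \<otimes> y"] inj_on_subset[OF inj_on_multc]) auto

lemma card_mult_inv_in_le:
  assumes "B \<subseteq> carrier G" "y \<in> carrier G" "finite V"
  shows "card {x \<in> B. y \<otimes> inv x \<in> V} \<le> card V"
proof (intro card_inj_on_le[of "\<lambda>x. y \<otimes> inv x"] inj_onI)
  fix x x' assume x: "x \<in> {x \<in> B. y \<otimes> inv x \<in> V}" "x' \<in> {x \<in> B. y \<otimes> inv x \<in> V}"
    and "y \<otimes> inv x = y \<otimes> inv x'"
  moreover have c: "x \<in> carrier G" "x' \<in> carrier G"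
    using x assms by auto
  ultimately have "inv x = inv x'"
    using assms by simp
  then show "x = x'"
    using c by (metis inv_inv)
qed (use assms in auto)

text \<open>
  Every overlap is an equation that determines \<open>x\<close> from the remaining elements, except for
  \<open>f - x = f' + x\<close>, which determines \<open>2 x\<close> and hence leaves at most \<open>j\<close> possibilities for \<open>x\<close>.
\<close>

lemma sum_overlaps_le:
  assumes B: "finite B" "B \<subseteq> carrier G" and R: "R' \<subseteq> B" and F: "F \<subseteq> B"
    and T: "finite {x \<in> carrier G. x \<otimes> x = \<one>}" "card {x \<in> carrier G. x \<otimes> x = \<one>} \<le> j"
  shows "(\<Sum>x\<in>B - R'. overlaps F R' x)
    \<le> card R' * (5 * (card F)\<^sup>2 + (card R')\<^sup>2) + 2 * (card F)\<^sup>2 * j"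
proof -
  let ?r = "card R'" and ?b = "card F"
  have fin: "finite R'" "finite F"
    using B R F by (auto intro: finite_subset)
  have car: "R' \<subseteq> carrier G" "F \<subseteq> carrier G"
    using B R F by auto
  define V where "V = (F <#> set_inv F) \<union> (R' <#> R')"
  have V: "finite V" "card V \<le> ?b\<^sup>2 + ?r\<^sup>2"
  proof -
    have "card V \<le> card (F <#> set_inv F) + card (R' <#> R')"
      unfolding V_def by (rule card_Un_le)
    also have "\<dots> \<le> ?b * card (set_inv F) + ?r * ?r"
      using fin by (intro add_mono card_set_mult_le finite_set_inv)
    also have "\<dots> \<le> ?b * ?b + ?r * ?r"
      using fin by (intro add_mono mult_le_mono2 card_set_inv_le order_refl)
    finally show "card V \<le> ?b\<^sup>2 + ?r\<^sup>2"
      by (simp add: power2_eq_square)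
  qed (use fin in \<open>auto simp: V_def finite_set_mult finite_set_inv\<close>)
  have rot: "card {x \<in> B - R'. x \<otimes> y \<in> V} \<le> ?b\<^sup>2 + ?r\<^sup>2" if "y \<in> R'" for y
  proof -
    have "card {x \<in> B - R'. x \<otimes> y \<in> V} \<le> card V"
      using B V car that by (intro card_mult_in_le) auto
    then show ?thesis using V by linarith
  qed
  define W where "W = (F <#> set_inv R') \<union> (F <#> R')"
  have W: "finite W" "card W \<le> 2 * (?b * ?r)"
  proof -
    have "card W \<le> card (F <#> set_inv R') + card (F <#> R')"
      unfolding W_def by (rule card_Un_le)
    also have "\<dots> \<le> ?b * card (set_inv R') + ?b * ?r"
      using fin by (intro add_mono card_set_mult_le finite_set_inv)
    also have "\<dots> \<le> ?b * ?r + ?b * ?r"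
      using fin by (intro add_mono mult_le_mono2 card_set_inv_le order_refl)
    finally show "card W \<le> 2 * (?b * ?r)"
      by simp
  qed (use fin in \<open>auto simp: W_def finite_set_mult finite_set_inv\<close>)
  have ref: "card {x \<in> B - R'. f \<otimes> inv x \<in> (F <#> set_inv R') \<union> (F <#> insert x R')}
      \<le> 2 * (?b * ?r) + ?b * j" if f: "f \<in> F" for f
  proof -
    have sub: "{x \<in> B - R'. f \<otimes> inv x \<in> (F <#> set_inv R') \<union> (F <#> insert x R')}
        \<subseteq> {x \<in> B. f \<otimes> inv x \<in> W} \<union> (\<Union>f'\<in>F. {x \<in> B. x \<otimes> x = f \<otimes> inv f'})"
    proof
      fix x assume x: "x \<in> {x \<in> B - R'. f \<otimes> inv x \<in> (F <#> set_inv R') \<union> (F <#> insert x R')}"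
      show "x \<in> {x \<in> B. f \<otimes> inv x \<in> W} \<union> (\<Union>f'\<in>F. {x \<in> B. x \<otimes> x = f \<otimes> inv f'})"
      proof (cases "f \<otimes> inv x \<in> W")
        case False
        then obtain f' where f': "f' \<in> F" "f \<otimes> inv x = f' \<otimes> x"
          using x by (auto simp: W_def set_mult_def)
        have c: "f \<in> carrier G" "f' \<in> carrier G" "x \<in> carrier G"
          using f f' x car B by auto
        have "f = f' \<otimes> x \<otimes> x"
          using f'(2) c by (metis inv_solve_right' m_closed)
        then have "x \<otimes> x = f \<otimes> inv f'"
          using c by (metis inv_solve_right m_assoc m_closed m_comm)
        then show ?thesis
          using x f' by auto
      qed (use x in auto)
    qed
    have "card {x \<in> B - R'. f \<otimes> inv x \<in> (F <#> set_inv R') \<union> (F <#> insert x R')}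
        \<le> card ({x \<in> B. f \<otimes> inv x \<in> W} \<union> (\<Union>f'\<in>F. {x \<in> B. x \<otimes> x = f \<otimes> inv f'}))"
      using B fin by (intro card_mono[OF _ sub]) auto
    also have "\<dots> \<le> card {x \<in> B. f \<otimes> inv x \<in> W} + card (\<Union>f'\<in>F. {x \<in> B. x \<otimes> x = f \<otimes> inv f'})"
      by (rule card_Un_le)
    also have "\<dots> \<le> card W + (\<Sum>f'\<in>F. card {x \<in> B. x \<otimes> x = f \<otimes> inv f'})"
      using B W fin f car by (intro add_mono card_mult_inv_in_le card_UN_le) auto
    also have "\<dots> \<le> 2 * (?b * ?r) + (\<Sum>f'\<in>F. j)"
      using W card_square_roots_le[OF T(1) B(2)] T(2)
      by (intro add_mono sum_mono) (auto intro: order_trans)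
    finally show ?thesis by simp
  qed
  have "(\<Sum>x\<in>B - R'. overlaps F R' x)
      = (\<Sum>y\<in>R'. card {x \<in> B - R'. x \<otimes> y \<in> V})
        + 2 * (\<Sum>f\<in>F. card {x \<in> B - R'. f \<otimes> inv x \<in> (F <#> set_inv R') \<union> (F <#> insert x R')})"
    using B fin sum_card_Collect_swap[of "B - R'" R' "\<lambda>x y. x \<otimes> y \<in> V"]
      sum_card_Collect_swap[of "B - R'" F
        "\<lambda>x f. f \<otimes> inv x \<in> (F <#> set_inv R') \<union> (F <#> insert x R')"]
    by (simp add: overlaps_def V_def sum.distrib sum_distrib_left[symmetric])
  also have "\<dots> \<le> ?r * (?b\<^sup>2 + ?r\<^sup>2) + 2 * (?b * (2 * (?b * ?r) + ?b * j))"
    using rot ref sum_bounded_above[of R' _ "?b\<^sup>2 + ?r\<^sup>2"] sum_bounded_above[of F _ "2 * (?b * ?r) + ?b * j"]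
    by (intro add_mono mult_le_mono2) auto
  also have "\<dots> = ?r * (5 * ?b\<^sup>2 + ?r\<^sup>2) + 2 * ?b\<^sup>2 * j"
    by (simp add: power2_eq_square algebra_simps)
  finally show ?thesis .
qed

text \<open>
  Every overlap involves a rotation, so averaging over the rotations alone bounds the overlaps,
  uniformly in the reflections.
\<close>

lemma few_not_MSTD:
  assumes B: "finite B" "B \<subseteq> carrier G" and F: "F \<subseteq> B" "card F = b"
    and T: "finite {x \<in> carrier G. x \<otimes> x = \<one>}" "card {x \<in> carrier G. x \<otimes> x = \<one>} \<le> j"
    and m: "6 \<le> m" "m + m\<^sup>2 * (60 + 2 * j) \<le> card B"
    and ab: "a + b = m" "0 < a" "7 * a \<le> 4 * m + 3"
  shows "10 * card {R. R \<subseteq> B \<and> card R = a \<and> \<not> MSTD (Dih G) (dih_set R F)} \<le> card B choose a"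
proof -
  define u where "u = 2 * b + 1 - a"
  have u: "u + a = 2 * b + 1" "0 < u"
    using m ab unfolding u_def by linarith+
  have fin: "finite R" if "R \<subseteq> B" for R
    using that B by (auto intro: finite_subset)
  have "0 < b"
    using m ab by linarith
  then have "F \<noteq> {}"
    using F by auto
  show ?thesis
  proof (rule markov_delete_element[where h = "overlaps F" and u = u])
    show "(\<Sum>x\<in>B - R'. overlaps F R' x) \<le> a * (5 * b\<^sup>2 + a\<^sup>2) + 2 * b\<^sup>2 * j"
      if "R' \<subseteq> B" "card R' = a - 1" for R'
    proof -
      have "(a - 1) * (5 * b\<^sup>2 + (a - 1)\<^sup>2) \<le> a * (5 * b\<^sup>2 + a\<^sup>2)"
        by (intro mult_le_mono add_mono power_mono) auto
      then show ?thesis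
        using sum_overlaps_le[OF B that(1) F(1) T] that(2) F(2) by simp
    qed
    show "a * u \<le> (\<Sum>x\<in>R. overlaps F (R - {x}) x)"
      if "R \<subseteq> B" "card R = a" "\<not> MSTD (Dih G) (dih_set R F)" for R
      using surplus_le_overlaps[of R F u] that fin[OF that(1)] fin[OF F(1)] B F u \<open>F \<noteq> {}\<close> by auto
    show "10 * (a * (5 * b\<^sup>2 + a\<^sup>2) + 2 * b\<^sup>2 * j) \<le> u * (card B - a + 1)"
      by (rule expected_overlaps_small[OF m(1) ab(1) ab(3) u(1) m(2)])
    show "a \<le> card B"
      using ab(1) m(2) by linarith
  qed (fact B(1) ab(2) u(2))+
qed

end

section \<open>Comparing the numbers of MSTD and MDTS sets\<close>

lemma card_dihedral_subsets:
  assumes B: "finite B"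
  shows "card {A. A \<subseteq> {0, 1} \<times> B \<and> card A = m \<and> P A}
    = (\<Sum>a\<le>m. card {(R, F). R \<subseteq> B \<and> F \<subseteq> B \<and> card R = a \<and> card F = m - a \<and> P (dih_set R F)})"
proof -
  define L where "L = (\<lambda>a. {(R, F). R \<subseteq> B \<and> F \<subseteq> B \<and> card R = a \<and> card F = m - a \<and> P (dih_set R F)})"
  have fin: "finite R" if "R \<subseteq> B" for R
    using that B by (rule finite_subset)
  have finL: "finite (L a)" for a
    by (rule finite_subset[of _ "Pow B \<times> Pow B"]) (use B in \<open>auto simp: L_def\<close>)
  have inj: "inj_on (\<lambda>(R, F). dih_set R F) (\<Union>a\<le>m. L a)"
    by (rule inj_on_inverseI[where g = "\<lambda>A. ({x. (0, x) \<in> A}, {x. (1, x) \<in> A})"]) auto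
  have img: "(\<lambda>(R, F). dih_set R F) ` (\<Union>a\<le>m. L a) = {A. A \<subseteq> {0, 1} \<times> B \<and> card A = m \<and> P A}"
  proof (intro equalityI subsetI)
    fix A assume A: "A \<in> {A. A \<subseteq> {0, 1} \<times> B \<and> card A = m \<and> P A}"
    define R F where "R = {x. (0, x) \<in> A}" and "F = {x. (1, x) \<in> A}"
    have eq: "A = dih_set R F"
      using A by (auto simp: dih_set_def R_def F_def)
    have sub: "R \<subseteq> B" "F \<subseteq> B"
      using A by (auto simp: R_def F_def)
    have "card R + card F = m"
      using A eq card_dih_set[of R F] fin sub by simp
    then have "(R, F) \<in> L (card R)" "card R \<le> m"
      using A sub eq by (auto simp: L_def)
    then show "A \<in> (\<lambda>(R, F). dih_set R F) ` (\<Union>a\<le>m. L a)"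
      using eq by force
  next
    fix A assume "A \<in> (\<lambda>(R, F). dih_set R F) ` (\<Union>a\<le>m. L a)"
    then obtain R F a where "A = dih_set R F" "a \<le> m" "R \<subseteq> B" "F \<subseteq> B" "card R = a"
      "card F = m - a" "P (dih_set R F)"
      by (auto simp: L_def)
    then show "A \<in> {A. A \<subseteq> {0, 1} \<times> B \<and> card A = m \<and> P A}"
      using card_dih_set[of R F] fin by (auto simp: dih_set_def)
  qed
  have "card {A. A \<subseteq> {0, 1} \<times> B \<and> card A = m \<and> P A} = card (\<Union>a\<le>m. L a)"
    unfolding img[symmetric] by (rule card_image[OF inj])
  also have "\<dots> = (\<Sum>a\<le>m. card (L a))"
    by (rule card_UN_disjoint) (use finL in \<open>auto simp: L_def\<close>)
  finally show ?thesis
    by (simp only: L_def)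
qed

lemma card_split_pairs:
  assumes B: "finite B"
  shows "card {(R, F). R \<subseteq> B \<and> F \<subseteq> B \<and> card R = a \<and> card F = b \<and> P R F}
    = (\<Sum>F | F \<subseteq> B \<and> card F = b. card {R. R \<subseteq> B \<and> card R = a \<and> P R F})"
proof -
  have "{(R, F). R \<subseteq> B \<and> F \<subseteq> B \<and> card R = a \<and> card F = b \<and> P R F}
      = prod.swap ` (SIGMA F:{F. F \<subseteq> B \<and> card F = b}. {R. R \<subseteq> B \<and> card R = a \<and> P R F})"
    by (auto simp: image_iff)
  then have "card {(R, F). R \<subseteq> B \<and> F \<subseteq> B \<and> card R = a \<and> card F = b \<and> P R F}
      = card (SIGMA F:{F. F \<subseteq> B \<and> card F = b}. {R. R \<subseteq> B \<and> card R = a \<and> P R F})"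
    by (simp add: card_image)
  also have "\<dots> = (\<Sum>F | F \<subseteq> B \<and> card F = b. card {R. R \<subseteq> B \<and> card R = a \<and> P R F})"
    using B by (intro card_SigmaI) auto
  finally show ?thesis .
qed

text \<open>
  Among the sets with \<open>1 \<le> a \<le> A\<close> rotations the MSTD sets outnumber the others by at least four fifths
  of the total weight.  That suffices even if all sets with \<open>a > A\<close> are MDTS.
\<close>

theorem (in comm_group) more_MSTD_than_MDTS:
  assumes B: "finite B" "B \<subseteq> carrier G"
    and T: "finite {x \<in> carrier G. x \<otimes> x = \<one>}" "card {x \<in> carrier G. x \<otimes> x = \<one>} \<le> j"
    and m: "6 \<le> m" "m + m\<^sup>2 * (60 + 2 * j) \<le> card B"
  shows "card {A. A \<subseteq> {0, 1} \<times> B \<and> card A = m \<and> MDTS (Dih G) A}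
    < card {A. A \<subseteq> {0, 1} \<times> B \<and> card A = m \<and> MSTD (Dih G) A}"
proof -
  define A where "A = (4 * m + 3) div 7"
  define w where "w = (\<lambda>a. (card B choose a) * (card B choose (m - a)))"
  define N where "N = (\<lambda>P a.
    card {(R, F). R \<subseteq> B \<and> F \<subseteq> B \<and> card R = a \<and> card F = m - a \<and> P (dih_set R F)})"
  have N_pairs: "N P a
      = (\<Sum>F | F \<subseteq> B \<and> card F = m - a. card {R. R \<subseteq> B \<and> card R = a \<and> P (dih_set R F)})" for P a
    unfolding N_def by (rule card_split_pairs[OF B(1)])
  have N_all: "N (\<lambda>_. True) a = w a" for a
    unfolding N_pairs w_def using B by (simp add: n_subsets mult.commute)
  have fin: "finite {(R, F). R \<subseteq> B \<and> F \<subseteq> B \<and> card R = a \<and> card F = m - a \<and> P (dih_set R F)}"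
    for P a
    by (rule finite_subset[of _ "Pow B \<times> Pow B"]) (use B in auto)
  have N_mono: "N P a \<le> N Q a" if "\<And>D. P D \<Longrightarrow> Q D" for P Q a
    unfolding N_def using that by (intro card_mono[OF fin]) auto
  have N_compl: "N P a + N (\<lambda>D. \<not> P D) a = w a" for P a
  proof -
    have "N P a + N (\<lambda>D. \<not> P D) a = N (\<lambda>_. True) a"
      unfolding N_def using fin[of a P] fin[of a "\<lambda>D. \<not> P D"]
      by (subst card_Un_disjoint[symmetric]) (auto intro!: arg_cong[where f = card])
    then show ?thesis by (simp only: N_all)
  qed
  have few: "10 * N (\<lambda>D. \<not> MSTD (Dih G) D) a \<le> w a" if a: "a \<in> {1..A}" for a
  proof -
    have a7: "7 * a \<le> 4 * m + 3" "0 < a" "a \<le> m"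
      using a m unfolding A_def by auto
    have "10 * N (\<lambda>D. \<not> MSTD (Dih G) D) a
        = (\<Sum>F | F \<subseteq> B \<and> card F = m - a.
            10 * card {R. R \<subseteq> B \<and> card R = a \<and> \<not> MSTD (Dih G) (dih_set R F)})"
      unfolding N_pairs by (simp add: sum_distrib_left)
    also have "\<dots> \<le> (\<Sum>F | F \<subseteq> B \<and> card F = m - a. card B choose a)"
      using a7 by (intro sum_mono few_not_MSTD[OF B _ _ T m]) auto
    also have "\<dots> = w a"
      using B by (simp add: n_subsets w_def mult.commute)
    finally show ?thesis .
  qed
  have "A < m" "1 \<le> A"
    using m unfolding A_def by linarith+
  then have split: "{..m} = {0} \<union> ({1..A} \<union> {A<..m})"
    by auto
  have sum_split: "(\<Sum>a\<le>m. f a) = f 0 + ((\<Sum>a\<in>{1..A}. f a) + (\<Sum>a\<in>{A<..m}. f a))" for f :: "nat \<Rightarrow> nat"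
    unfolding split by (simp add: sum.union_disjoint ivl_disj_int)
  have MDTS0: "N (MDTS (Dih G)) 0 = 0"
  proof -
    have "\<not> MDTS (Dih G) (dih_set R F)" if "R \<subseteq> B" "card R = 0" "F \<subseteq> B" for R F
    proof -
      have "R = {}"
        using that B by (metis card_0_eq finite_subset)
      then show ?thesis
        using that B not_MDTS_reflections by auto
    qed
    then have "{(R, F). R \<subseteq> B \<and> F \<subseteq> B \<and> card R = 0 \<and> card F = m - 0 \<and> MDTS (Dih G) (dih_set R F)} = {}"
      by blast
    then show ?thesis
      by (simp only: N_def card.empty)
  qed
  have "10 * N (MDTS (Dih G)) a \<le> w a" if "a \<in> {1..A}" for a
    using few[OF that] N_mono[of "MDTS (Dih G)" "\<lambda>D. \<not> MSTD (Dih G) D" a]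
    by (fastforce simp: MSTD_def MDTS_def)
  then have good: "10 * (\<Sum>a\<in>{1..A}. N (MDTS (Dih G)) a) \<le> (\<Sum>a\<in>{1..A}. w a)"
    unfolding sum_distrib_left by (rule sum_mono)
  have tail: "(\<Sum>a\<in>{A<..m}. N (MDTS (Dih G)) a) \<le> (\<Sum>a\<in>{A<..m}. w a)"
    using N_compl[of "MDTS (Dih G)"] by (intro sum_mono) (metis le_add1)
  have "9 * w a \<le> 10 * N (MSTD (Dih G)) a" if "a \<in> {1..A}" for a
    using few[OF that] N_compl[of "MSTD (Dih G)" a] by linarith
  then have MSTD: "9 * (\<Sum>a\<in>{1..A}. w a) \<le> 10 * (\<Sum>a\<in>{1..A}. N (MSTD (Dih G)) a)"
    unfolding sum_distrib_left by (rule sum_mono)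
  have "m \<le> card B"
    using m(2) by linarith
  then have "10 * (\<Sum>a\<in>{A<..m}. w a) < 8 * (\<Sum>a\<in>{1..A}. w a)"
    unfolding w_def by (intro split_weights_tail_less) (use m A_def in auto)
  then have "(\<Sum>a\<le>m. N (MDTS (Dih G)) a) < (\<Sum>a\<le>m. N (MSTD (Dih G)) a)"
    unfolding sum_split MDTS0 using good tail MSTD by linarith
  then show ?thesis
    unfolding card_dihedral_subsets[OF B(1)] N_def .
qed

section \<open>Sums of cyclic groups\<close>

lemma comm_group_cyclic_sum: "comm_group (cyclic_sum d k r q)"
proof (rule group.group_comm_groupI)
  show "group (cyclic_sum d k r q)"
    unfolding cyclic_sum_def by (intro product_group) auto
qed (auto simp: cyclic_sum_def add.commute intro!: restrict_ext)

lemma mem_carrier_cyclic_sum: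
  "g \<in> carrier (cyclic_sum d k r q) \<longleftrightarrow>
    g \<in> extensional (SIGMA a:{..k}. {1..r a}) \<and>
    (\<forall>b\<in>{1..r 0}. g (0, b) \<in> carrier (integer_mod_group d)) \<and>
    (\<forall>a\<in>{1..k}. \<forall>b\<in>{1..r a}. g (a, b) \<in> carrier (integer_mod_group (q a)))"
proof -
  have k: "{..k} = insert 0 {1..k}"
    by auto
  show ?thesis
    unfolding cyclic_sum_def k by (auto simp: PiE_iff)
qed

lemma finite_carrier_cyclic_sum:
  assumes "0 < d" "\<And>i. 1 \<le> i \<Longrightarrow> i \<le> k \<Longrightarrow> 0 < q i"
  shows "finite (carrier (cyclic_sum d k r q))"
  unfolding cyclic_sum_def using assms
  by (auto intro!: finite_PiE simp: carrier_integer_mod_group)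

lemma Dih_box_eq:
  assumes "0 < d"
  shows "Dih_box d k r q = {0, 1} \<times> carrier (cyclic_sum d k r q)"
proof -
  have "g \<in> carrier (fg_abelian k r q) \<and> (\<forall>b\<in>{1..r 0}. 0 \<le> g (0, b) \<and> g (0, b) < int d)
      \<longleftrightarrow> g \<in> carrier (cyclic_sum d k r q)" for g
    using assms unfolding fg_abelian_def mem_carrier_cyclic_sum
    by (auto simp: carrier_integer_mod_group)
  then show ?thesis
    unfolding Dih_box_def carrier_Dih by auto
qed

lemma carrier_cyclic_sum_subset: "carrier (cyclic_sum d k r q) \<subseteq> carrier (fg_abelian k r q)"
  unfolding fg_abelian_def subset_iff mem_carrier_cyclic_sum
  by (simp add: carrier_integer_mod_group[of 0])

text \<open>
  An element of order at most two of the infinite group has no \<open>\<int>\<close>-coordinates, so that it is also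
  an element of order at most two after the factors \<open>\<int>\<close> are replaced by finite cyclic groups.
\<close>

lemma square_roots_of_one_subset:
  assumes d: "0 < d"
  shows "{x \<in> carrier (fg_abelian k r q). x \<otimes>\<^bsub>fg_abelian k r q\<^esub> x = \<one>\<^bsub>fg_abelian k r q\<^esub>}
    \<subseteq> {x \<in> carrier (cyclic_sum d k r q). group.ord (cyclic_sum d k r q) x \<in> {1, 2}}"
proof
  let ?G = "fg_abelian k r q" and ?H = "cyclic_sum d k r q"
  let ?I = "SIGMA a:{..k}. {1..r a}"
  interpret H: comm_group ?H
    by (rule comm_group_cyclic_sum)
  fix x assume "x \<in> {x \<in> carrier ?G. x \<otimes>\<^bsub>?G\<^esub> x = \<one>\<^bsub>?G\<^esub>}"
  then have x: "x \<in> carrier ?G" "x \<otimes>\<^bsub>?G\<^esub> x = \<one>\<^bsub>?G\<^esub>"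
    by auto
  have sq: "(x (a, b) + x (a, b)) mod int (if a = 0 then 0 else q a) = 0" if "(a, b) \<in> ?I" for a b
    using fun_cong[OF x(2), of "(a, b)"] that by (simp add: fg_abelian_def cyclic_sum_def)
  have zero: "x (0, b) = 0" if "(0, b) \<in> ?I" for b
    using sq[OF that] by simp
  have car: "x \<in> carrier ?H"
    using x(1) zero unfolding fg_abelian_def mem_carrier_cyclic_sum by simp
  have "(x (a, b) + x (a, b)) mod int (if a = 0 then d else q a) = 0" if "(a, b) \<in> ?I" for a b
    using sq[OF that] zero that by (cases "a = 0") auto
  then have "x \<otimes>\<^bsub>?H\<^esub> x = \<one>\<^bsub>?H\<^esub>"
    unfolding cyclic_sum_def by (auto simp: fun_eq_iff restrict_def)
  then have "x [^]\<^bsub>?H\<^esub> (2 :: nat) = \<one>\<^bsub>?H\<^esub>"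
    using car by (simp add: numeral_2_eq_2)
  then have "group.ord ?H x dvd 2"
    using car H.pow_eq_id by blast
  then have "group.ord ?H x \<in> {1, 2}"
    using dvd_imp_le[of "group.ord ?H x" 2] by (cases "group.ord ?H x = 0") auto
  then show "x \<in> {x \<in> carrier ?H. group.ord ?H x \<in> {1, 2}}"
    using car by simp
qed

theorem corollary3p6:
  fixes k :: nat and r q :: "nat \<Rightarrow> nat" and \<alpha> m n j :: nat and c :: real
    and G G' :: "(nat \<times> nat \<Rightarrow> int) monoid"
    and S :: "(int \<times> (nat \<times> nat \<Rightarrow> int)) set set"
  assumes q: "\<And>i. 1 \<le> i \<Longrightarrow> i \<le> k \<Longrightarrow> primepow (q i)"
    and \<alpha>: "\<alpha> > 0"
    and G: "G = fg_abelian k r q"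
    and G': "G' = cyclic_sum \<alpha> k r q"
    and n: "n = order G'"
    and j: "j = num_ord_le_2 G'"
    and c: "c = 1.3229 / sqrt (111 + 5 * real j)"
    and S: "S = {A. A \<subseteq> Dih_box \<alpha> k r q \<and> card A = m}"
    and m: "6 \<le> m" "real m \<le> c * sqrt (real n)"
  shows "card {A \<in> S. MSTD (Dih G) A} > card {A \<in> S. MDTS (Dih G) A}"
proof -
  interpret G: comm_group G
    unfolding G fg_abelian_def by (rule comm_group_cyclic_sum)
  have fin: "finite (carrier G')"
    unfolding G' using \<alpha> q primepow_gt_0_nat by (intro finite_carrier_cyclic_sum) auto
  let ?T = "{x \<in> carrier G. x \<otimes>\<^bsub>G\<^esub> x = \<one>\<^bsub>G\<^esub>}"
    and ?T' = "{x \<in> carrier G'. group.ord G' x \<in> {1, 2}}"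
  have T: "?T \<subseteq> ?T'"
    unfolding G G' by (rule square_roots_of_one_subset[OF \<alpha>])
  have fin': "finite ?T'"
    using fin by simp
  have "card ?T \<le> j"
    unfolding j num_ord_le_2_def by (rule card_mono[OF fin' T])
  moreover have "m + m\<^sup>2 * (60 + 2 * j) \<le> card (carrier G')"
    using size_bound_imp_quadratic[of m j n] m unfolding c n order_def by blast
  moreover have "carrier G' \<subseteq> carrier G"
    unfolding G G' by (rule carrier_cyclic_sum_subset)
  ultimately have "card {A. A \<subseteq> {0, 1} \<times> carrier G' \<and> card A = m \<and> MDTS (Dih G) A}
      < card {A. A \<subseteq> {0, 1} \<times> carrier G' \<and> card A = m \<and> MSTD (Dih G) A}"
    using fin finite_subset[OF T fin'] m(1) by (intro G.more_MSTD_than_MDTS)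
  then show ?thesis
    unfolding S G' Dih_box_eq[OF \<alpha>] by (simp add: conj_assoc)
qed

end
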